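(* Let $(\gamma_n)_{n\in\mathbb{N}}$ and $(\delta_n)_{n\in\mathbb{N}}$ be sequences of independent random variables, each uniformly distributed (with respect to Lebesgue measure) in $[0,1)$. Then almost surely the following holds: for all $\alpha,\beta\in\mathbb{R}$, \[\liminf_{n\to\infty} n(\log n)\,\|n\alpha-\gamma_n\|\,\|n\beta-\delta_n\|\le 1.\]
   Context: For $x\in\mathbb{R}$, $\|x\|$ denotes the distance from $x$ to the nearest integer. The random variables $\gamma_1,\gamma_2,\dots,\delta_1,\delta_2,\dots$ are all mutually independent. *)

theory Defs
  imports "HOL-Probability.Probability"
begin

definition nint_dist :: "real \<Rightarrow> real" where
  "nint_dist x = infdist x \<int>"

end

theory Submission
  imports Defs "HOL-Library.Periodic_Fun" "HOL-Real_Asymp.Real_Asymp"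
begin

text \<open>
  For fixed \<open>\<alpha>, \<beta>\<close> the distances \<open>\<parallel>n \<alpha> - \<gamma>\<^sub>n\<parallel>\<close> and \<open>\<parallel>n \<beta> - \<delta>\<^sub>n\<parallel>\<close> are independent and uniform on
  \<open>[0, 1/2]\<close>, so their product is at most \<open>t\<close> with probability \<open>4 t (1 - ln (4 t))\<close>; for
  \<open>t = c / (n ln n)\<close> and \<open>n\<close> large this is at least \<open>4 c / n\<close>. By independence in \<open>n\<close>, the
  probability that no \<open>n\<close> in \<open>[N, m]\<close> achieves this is at most \<open>(N / (m + 1)) powr (4 c)\<close>. Moving
  \<open>\<alpha>, \<beta>\<close> by \<open>m powr -(1 + c)\<close> changes \<open>n ln n\<close> times the product by at most \<open>m powr (1 - c) * ln m\<close>
  for all \<open>n \<le> m\<close>, so it suffices to control about \<open>m powr (2 + 2 c)\<close> grid points of the unit square.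
  The union bound over this grid is of order \<open>m powr (2 - 2 c)\<close>; both quantities tend to \<open>0\<close> exactly
  when \<open>c > 1\<close>, which is where the constant comes from.
\<close>

subsection \<open>The distance to the nearest integer\<close>

lemma nint_dist_eq_abs_round: "nint_dist x = \<bar>x - of_int (round x)\<bar>"
proof (rule antisym)
  show "nint_dist x \<le> \<bar>x - of_int (round x)\<bar>"
    unfolding nint_dist_def by (metis Ints_of_int dist_real_def infdist_le)
  show "\<bar>x - of_int (round x)\<bar> \<le> nint_dist x"
    unfolding nint_dist_def infdist_def
    by (auto intro!: cINF_greatest simp: dist_real_def round_diff_minimal elim!: Ints_cases)
qed

lemma nint_dist_nonneg [simp]: "0 \<le> nint_dist x"
  by (simp add: nint_dist_def infdist_nonneg)

lemma nint_dist_le_half: "nint_dist x \<le> 1 / 2"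
  using of_int_round_abs_le[of x] by (simp add: nint_dist_eq_abs_round abs_minus_commute)

lemma nint_dist_eq_abs:
  assumes "\<bar>x\<bar> \<le> 1 / 2"
  shows "nint_dist x = \<bar>x\<bar>"
proof (rule antisym)
  show "nint_dist x \<le> \<bar>x\<bar>"
    using round_diff_minimal[of x 0] by (simp add: nint_dist_eq_abs_round)
  have "\<bar>x\<bar> \<le> \<bar>x - of_int k\<bar>" for k :: int
  proof (cases "k = 0")
    case False
    then have "1 \<le> \<bar>real_of_int k\<bar>" by linarith
    then show ?thesis using assms by linarith
  qed simp
  then show "\<bar>x\<bar> \<le> nint_dist x" by (simp add: nint_dist_eq_abs_round)
qed

lemma nint_dist_add_one: "nint_dist (x + 1) = nint_dist x"
proof -
  have "round (x + 1) = round x + 1"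
    unfolding round_def by (metis add.commute add.left_commute floor_add_int of_int_1)
  then show ?thesis by (simp add: nint_dist_eq_abs_round)
qed

interpretation nint_dist: periodic_fun_simple' nint_dist
  by standard (rule nint_dist_add_one)

lemma nint_dist_diff_le: "nint_dist x - nint_dist y \<le> \<bar>x - y\<bar>"
  using infdist_triangle[of x \<int> y] by (simp add: nint_dist_def dist_real_def)

lemma nint_dist_mult_diff_le:
  "nint_dist x * nint_dist y - nint_dist x' * nint_dist y' \<le> (\<bar>x - x'\<bar> + \<bar>y - y'\<bar>) / 2"
proof -
  have "nint_dist x * nint_dist y - nint_dist x' * nint_dist y' =
      (nint_dist x - nint_dist x') * nint_dist y + (nint_dist y - nint_dist y') * nint_dist x'"
    by (simp add: algebra_simps)
  also have "\<dots> \<le> \<bar>x - x'\<bar> * (1 / 2) + \<bar>y - y'\<bar> * (1 / 2)"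
    by (intro add_mono mult_mono nint_dist_diff_le nint_dist_le_half) simp_all
  finally show ?thesis by simp
qed

lemma borel_measurable_nint_dist [measurable]: "nint_dist \<in> borel_measurable borel"
  unfolding nint_dist_def by (intro borel_measurable_continuous_onI continuous_intros)

subsection \<open>Shifted uniform variables modulo one\<close>

lemma emeasure_lborel_period:
  fixes A :: "real set"
  assumes "0 < p" and [measurable]: "A \<in> sets borel" and period: "\<And>x. x + p \<in> A \<longleftrightarrow> x \<in> A"
  shows "emeasure lborel (A \<inter> {c..<c + p}) = emeasure lborel (A \<inter> {0..<p})"
proof -
  interpret periodic_fun_simple "\<lambda>x. x \<in> A" p
    by standard (rule period)
  have translate: "emeasure lborel (A \<inter> {x + of_int k * p..<y + of_int k * p}) =
      emeasure lborel (A \<inter> {x..<y})" for x y k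
  proof -
    have "emeasure lborel (A \<inter> {x + of_int k * p..<y + of_int k * p}) =
        emeasure lborel ((+) (of_int k * p) -` (A \<inter> {x + of_int k * p..<y + of_int k * p}))"
      by (subst lborel_distr_plus[of "of_int k * p", symmetric], subst emeasure_distr) auto
    also have "(+) (of_int k * p) -` (A \<inter> {x + of_int k * p..<y + of_int k * p}) = A \<inter> {x..<y}"
      by (auto simp: plus_of_int add.commute[of "of_int k * p"])
    finally show ?thesis .
  qed
  define d where "d = c - of_int \<lfloor>c / p\<rfloor> * p"
  have d_bounds: "0 \<le> d" "d < p"
    unfolding d_def using floor_divide_lower[OF \<open>0 < p\<close>, of c] floor_divide_upper[OF \<open>0 < p\<close>, of c]
    by (simp_all add: algebra_simps)
  have "emeasure lborel (A \<inter> {c..<c + p}) = emeasure lborel (A \<inter> {d..<d + p})"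
    using translate[of d "\<lfloor>c / p\<rfloor>" "d + p"] by (simp add: d_def algebra_simps)
  also have "\<dots> = emeasure lborel (A \<inter> {d..<p}) + emeasure lborel (A \<inter> {p..<d + p})"
    using d_bounds by (subst plus_emeasure) (auto intro!: arg_cong[where f = "emeasure lborel"])
  also have "emeasure lborel (A \<inter> {p..<d + p}) = emeasure lborel (A \<inter> {0..<d})"
    using translate[of 0 1 d] by simp
  also have "emeasure lborel (A \<inter> {d..<p}) + \<dots> = emeasure lborel (A \<inter> {0..<p})"
    using d_bounds by (subst plus_emeasure) (auto intro!: arg_cong[where f = "emeasure lborel"])
  finally show ?thesis .
qed

lemma measure_lborel_nint_dist_le:
  assumes "0 \<le> r" "r \<le> 1 / 2"
  shows "measure lborel ({0..<1} \<inter> {u. nint_dist (a - u) \<le> r}) = 2 * r"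
proof -
  let ?A = "{u. nint_dist (a - u) \<le> r}" and ?I = "{a - 1 / 2..<a - 1 / 2 + 1}"
  have "u + 1 \<in> ?A \<longleftrightarrow> u \<in> ?A" for u
    using nint_dist.minus_1[of "a - u"] by (simp add: algebra_simps)
  moreover have "?A \<in> sets borel" by measurable
  ultimately have "emeasure lborel (?A \<inter> ?I) = emeasure lborel (?A \<inter> {0..<1})"
    by (intro emeasure_lborel_period) simp_all
  then have "measure lborel ({0..<1} \<inter> ?A) = measure lborel (?A \<inter> ?I)"
    by (simp add: measure_def Int_commute)
  also have "?A \<inter> ?I = {u. \<bar>a - u\<bar> \<le> r} \<inter> ?I"
  proof -
    have "nint_dist (a - u) = \<bar>a - u\<bar>" if "u \<in> ?I" for u
      using that by (intro nint_dist_eq_abs abs_leI) auto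
    then show ?thesis by auto
  qed
  also have "\<dots> = (if r = 1 / 2 then {a - r..<a + r} else {a - r..a + r})"
    using assms by (auto simp: abs_le_iff)
  also have "measure lborel \<dots> = 2 * r"
    using assms by simp
  finally show ?thesis .
qed

lemma (in prob_space) distributed_nint_dist_diff_uniform:
  assumes [measurable]: "random_variable borel X"
    and distr: "distr M borel X = uniform_measure lborel {0..<1}"
  shows "distributed M lborel (\<lambda>\<omega>. nint_dist (a - X \<omega>))
    (\<lambda>x. indicator {0..1 / 2} x / measure lborel {0..1 / 2 :: real})"
proof (rule uniform_distrI_borel_atLeastAtMost)
  fix r :: real assume r_bounds: "0 \<le> r" "r \<le> 1 / 2"
  have "\<P>(\<omega> in M. nint_dist (a - X \<omega>) \<le> r) = measure (distr M borel X) {u. nint_dist (a - u) \<le> r}"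
    by (subst measure_distr) (auto intro!: arg_cong[where f = prob])
  also have "\<dots> = 2 * r"
    unfolding distr using r_bounds by (simp add: measure_lborel_nint_dist_le)
  finally show "\<P>(\<omega> in M. nint_dist (a - X \<omega>) \<le> r) = (r - 0) / (1 / 2 - 0)" by simp
qed simp_all

subsection \<open>Products of independent uniform variables\<close>

lemma (in prob_space) indep_vars_imp_indep_var:
  assumes indep: "indep_vars M' X I" and "i \<in> I" "j \<in> I" "i \<noteq> j"
  shows "indep_var (M' i) (X i) (M' j) (X j)"
proof -
  have "indep_var (PiM {i} M') (\<lambda>\<omega>. \<lambda>k\<in>{i}. X k \<omega>) (PiM {j} M') (\<lambda>\<omega>. \<lambda>k\<in>{j}. X k \<omega>)"
    using assms by (intro indep_var_restrict[OF indep]) auto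
  then have "indep_var (M' i) ((\<lambda>f. f i) \<circ> (\<lambda>\<omega>. \<lambda>k\<in>{i}. X k \<omega>))
      (M' j) ((\<lambda>f. f j) \<circ> (\<lambda>\<omega>. \<lambda>k\<in>{j}. X k \<omega>))"
    by (rule indep_var_compose) measurable
  then show ?thesis by (simp add: comp_def)
qed

lemma (in prob_space) emeasure_indep_var_eq_nn_integral:
  assumes indep: "indep_var S X T Y" and [measurable]: "A \<in> sets (S \<Otimes>\<^sub>M T)"
  shows "emeasure M {\<omega> \<in> space M. (X \<omega>, Y \<omega>) \<in> A} =
    (\<integral>\<^sup>+x. emeasure M {\<omega> \<in> space M. (x, Y \<omega>) \<in> A} \<partial>distr M S X)"
proof -
  have [measurable]: "X \<in> measurable M S" "Y \<in> measurable M T"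
    using indep by (auto dest: indep_var_rv1 indep_var_rv2)
  interpret Y: prob_space "distr M T Y" by (rule prob_space_distr) measurable
  have "emeasure M {\<omega> \<in> space M. (X \<omega>, Y \<omega>) \<in> A} =
      emeasure (distr M (S \<Otimes>\<^sub>M T) (\<lambda>\<omega>. (X \<omega>, Y \<omega>))) A"
    by (subst emeasure_distr) (auto intro!: arg_cong[where f = "emeasure M"])
  also have "\<dots> = emeasure (distr M S X \<Otimes>\<^sub>M distr M T Y) A"
    using indep by (simp add: indep_var_distribution_eq)
  also have "\<dots> = (\<integral>\<^sup>+x. emeasure (distr M T Y) (Pair x -` A) \<partial>distr M S X)"
    by (intro Y.emeasure_pair_measure_alt) (simp cong: sets_pair_measure_cong)
  also have "\<dots> = (\<integral>\<^sup>+x. emeasure M {\<omega> \<in> space M. (x, Y \<omega>) \<in> A} \<partial>distr M S X)"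
    by (intro nn_integral_cong, subst emeasure_distr)
      (auto intro!: arg_cong[where f = "emeasure M"] sets_Pair1)
  finally show ?thesis .
qed

lemma (in prob_space) prob_cmult_uniform_le:
  fixes x b :: real
  assumes Y: "distributed M lborel Y (\<lambda>y. indicator {0..b} y / measure lborel {0..b})"
    and "0 < x" "0 \<le> t"
  shows "\<P>(\<omega> in M. x * Y \<omega> \<le> t) = min 1 (t / (x * b))"
proof -
  have b_pos: "0 < b" using uniform_distributed_bounds[OF Y] .
  have "\<P>(\<omega> in M. x * Y \<omega> \<le> t) = \<P>(\<omega> in M. Y \<omega> \<le> t / x)"
    using \<open>0 < x\<close> by (simp add: field_simps)
  also have "\<dots> = min 1 (t / (x * b))"
  proof (cases "t / x \<le> b")
    case True
    then show ?thesis
      using uniform_distributed_measure[OF Y, of "t / x"] assms(2,3) b_pos by (simp add: field_simps)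
  next
    case False
    have [measurable]: "random_variable borel Y"
      using distributed_measurable[OF Y] by simp
    have "1 = \<P>(\<omega> in M. Y \<omega> \<le> b)"
      using uniform_distributed_measure[OF Y, of b] b_pos by simp
    also have "\<dots> \<le> \<P>(\<omega> in M. Y \<omega> \<le> t / x)"
      using False by (intro finite_measure_mono) auto
    finally have "\<P>(\<omega> in M. Y \<omega> \<le> t / x) = 1"
      by (simp add: antisym)
    moreover have "1 \<le> t / (x * b)"
      using False \<open>0 < x\<close> b_pos by (simp add: field_simps)
    ultimately show ?thesis by simp
  qed
  finally show ?thesis .
qed

lemma nn_integral_min_one_divide:
  fixes s a :: real
  assumes "0 < s" "s \<le> a"
  shows "(\<integral>\<^sup>+x\<in>{0<..a}. ennreal (min 1 (s / x)) \<partial>lborel) = ennreal (s * (1 + ln (a / s)))"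
proof -
  have "(\<integral>\<^sup>+x\<in>{0<..a}. ennreal (min 1 (s / x)) \<partial>lborel) =
      (\<integral>\<^sup>+x. indicator {0<..<s} x + ennreal (s / x) * indicator {s..a} x \<partial>lborel)"
    using assms by (intro nn_integral_cong) (auto simp: min_def field_simps split: split_indicator)
  also have "\<dots> = ennreal s + (\<integral>\<^sup>+x\<in>{s..a}. ennreal (s / x) \<partial>lborel)"
    using assms by (subst nn_integral_add) auto
  also have "(\<integral>\<^sup>+x\<in>{s..a}. ennreal (s / x) \<partial>lborel) = ennreal (s * ln a - s * ln s)"
    using assms by (intro nn_integral_FTC_Icc) (auto intro!: derivative_eq_intros)
  also have "\<dots> = ennreal (s * ln (a / s))"
    using assms by (simp add: ln_div right_diff_distrib)
  finally show ?thesis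
    using assms by (simp add: distrib_left flip: ennreal_plus)
qed

lemma (in prob_space) emeasure_mult_uniform_le:
  fixes a t :: real
  assumes indep: "indep_var borel X borel Y"
    and X: "distributed M lborel X (\<lambda>x. indicator {0..a} x / measure lborel {0..a})"
  shows "emeasure M {\<omega> \<in> space M. X \<omega> * Y \<omega> \<le> t} =
    ennreal (1 / a) * (\<integral>\<^sup>+x\<in>{0<..a}. emeasure M {\<omega> \<in> space M. x * Y \<omega> \<le> t} \<partial>lborel)"
proof -
  let ?G = "\<lambda>x. emeasure M {\<omega> \<in> space M. x * Y \<omega> \<le> t}"
  have a_pos: "0 < a" using uniform_distributed_bounds[OF X] .
  have [measurable]: "random_variable borel Y" using indep by (rule indep_var_rv2)
  have "{p. fst p * snd p \<le> t} \<in> sets (borel \<Otimes>\<^sub>M borel)"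
    unfolding borel_prod by (intro borel_closed closed_Collect_le continuous_intros)
  from emeasure_indep_var_eq_nn_integral[OF indep this]
  have "emeasure M {\<omega> \<in> space M. X \<omega> * Y \<omega> \<le> t} = (\<integral>\<^sup>+x. ?G x \<partial>distr M borel X)"
    by simp
  also have "distr M borel X = density lborel (\<lambda>x. ennreal (indicator {0..a} x / a))"
    using distributed_distr_eq_density[OF X] a_pos by (simp cong: distr_cong)
  also have "(\<integral>\<^sup>+x. ?G x \<partial>\<dots>) = (\<integral>\<^sup>+x. ennreal (indicator {0..a} x / a) * ?G x \<partial>lborel)"
    by (simp add: nn_integral_density)
  also have "\<dots> = (\<integral>\<^sup>+x. ennreal (1 / a) * (?G x * indicator {0<..a} x) \<partial>lborel)"
  proof (rule nn_integral_cong_AE)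
    show "AE x in lborel. ennreal (indicator {0..a} x / a) * ?G x =
        ennreal (1 / a) * (?G x * indicator {0<..a} x)"
      using AE_lborel_singleton[of 0]
      by eventually_elim (auto split: split_indicator)
  qed
  also have "\<dots> = ennreal (1 / a) * (\<integral>\<^sup>+x\<in>{0<..a}. ?G x \<partial>lborel)"
    by (rule nn_integral_cmult) measurable
  finally show ?thesis .
qed

lemma (in prob_space) prob_mult_indep_uniform_le:
  fixes a b t :: real
  assumes indep: "indep_var borel X borel Y"
    and X: "distributed M lborel X (\<lambda>x. indicator {0..a} x / measure lborel {0..a})"
    and Y: "distributed M lborel Y (\<lambda>y. indicator {0..b} y / measure lborel {0..b})"
    and t_bounds: "0 < t" "t \<le> a * b"
  shows "\<P>(\<omega> in M. X \<omega> * Y \<omega> \<le> t) = t / (a * b) * (1 - ln (t / (a * b)))"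
proof -
  have ab_pos: "0 < a" "0 < b" using uniform_distributed_bounds X Y by blast+
  have "emeasure M {\<omega> \<in> space M. X \<omega> * Y \<omega> \<le> t} =
      ennreal (1 / a) * (\<integral>\<^sup>+x\<in>{0<..a}. emeasure M {\<omega> \<in> space M. x * Y \<omega> \<le> t} \<partial>lborel)"
    by (rule emeasure_mult_uniform_le[OF indep X])
  also have "(\<integral>\<^sup>+x\<in>{0<..a}. emeasure M {\<omega> \<in> space M. x * Y \<omega> \<le> t} \<partial>lborel) =
      (\<integral>\<^sup>+x\<in>{0<..a}. ennreal (min 1 (t / b / x)) \<partial>lborel)"
    using prob_cmult_uniform_le[OF Y] t_bounds
    by (intro nn_integral_cong) (auto simp: emeasure_eq_measure mult.commute split: split_indicator)
  also have "\<dots> = ennreal (t / b * (1 + ln (a / (t / b))))"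
    using ab_pos t_bounds by (intro nn_integral_min_one_divide) (simp_all add: pos_divide_le_eq)
  also have "ennreal (1 / a) * \<dots> = ennreal (1 / a * (t / b * (1 + ln (a / (t / b)))))"
    using ab_pos by (intro ennreal_mult'[symmetric]) simp
  also have "1 / a * (t / b * (1 + ln (a / (t / b)))) = t / (a * b) * (1 - ln (t / (a * b)))"
    using ab_pos t_bounds by (simp add: ln_div ln_mult algebra_simps add_divide_distrib)
  finally have "ennreal (\<P>(\<omega> in M. X \<omega> * Y \<omega> \<le> t)) = ennreal (t / (a * b) * (1 - ln (t / (a * b))))"
    by (simp add: emeasure_eq_measure)
  moreover have "0 \<le> t / (a * b) * (1 - ln (t / (a * b)))"
  proof (rule mult_nonneg_nonneg)
    have "ln (t / (a * b)) \<le> 0" using ab_pos t_bounds by simp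
    then show "0 \<le> 1 - ln (t / (a * b))" by linarith
  qed (use ab_pos t_bounds in simp)
  ultimately show ?thesis by (simp only: ennreal_inj measure_nonneg)
qed

subsection \<open>Inequalities, limits and null sets\<close>

lemma one_minus_divide_le_powr:
  fixes x p :: real
  assumes "0 < x" "0 \<le> p"
  shows "1 - p / x \<le> (x / (x + 1)) powr p"
proof -
  have "1 / x \<ge> ln (1 + 1 / x)"
    using assms by (intro ln_add_one_self_le_self) simp
  also have "ln (1 + 1 / x) = - ln (x / (x + 1))"
    using assms by (subst ln_inverse[symmetric]) (simp_all add: field_simps)
  finally have "- (1 / x) \<le> ln (x / (x + 1))" by simp
  then have "- p / x \<le> p * ln (x / (x + 1))"
    using mult_left_mono[OF _ \<open>0 \<le> p\<close>] by fastforce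
  then have "exp (- p / x) \<le> (x / (x + 1)) powr p"
    using assms by (simp add: powr_def)
  with exp_ge_add_one_self[of "- p / x"] show ?thesis by simp
qed

lemma prod_atLeastAtMost_telescope:
  fixes f :: "nat \<Rightarrow> 'a::field"
  assumes "m \<le> n" "\<And>i. i \<in> {m..n} \<Longrightarrow> f (Suc i) \<noteq> 0"
  shows "(\<Prod>i=m..n. f i / f (Suc i)) = f m / f (Suc n)"
  using assms by (induction n rule: dec_induct) auto

lemma power2_mult_ln_mono:
  fixes m n :: nat
  assumes "n \<le> m"
  shows "(real n)\<^sup>2 * ln (real n) \<le> (real m)\<^sup>2 * ln (real m)"
proof (cases "n = 0")
  case False
  with assms show ?thesis by (intro mult_mono) auto
qed (cases "m = 0"; simp)

lemma Liminf_ereal_le_if_frequently_rat: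
  assumes "\<And>q :: rat. c < of_rat q \<Longrightarrow> \<exists>\<^sub>F x in F. f x \<le> of_rat q"
  shows "Liminf F (\<lambda>x. ereal (f x)) \<le> ereal c"
proof (rule ccontr)
  assume "\<not> ?thesis"
  then obtain q :: rat where "ereal c < ereal (of_rat q)" and
    q_less: "ereal (of_rat q) < Liminf F (\<lambda>x. ereal (f x))"
    using ereal_dense3[of "ereal c"] by (auto simp: not_le)
  then have "\<exists>\<^sub>F x in F. f x \<le> of_rat q" using assms by simp
  moreover have "\<forall>\<^sub>F x in F. of_rat q < f x"
    using less_LiminfD[OF q_less] by simp
  ultimately show False by (simp add: frequently_def not_le)
qed

lemma (in finite_measure) AE_I_cover_tendsto_0:
  assumes "F \<noteq> bot" and lim: "((\<lambda>i. measure M (A i)) \<longlongrightarrow> 0) F"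
    and covers: "\<forall>\<^sub>F i in F. A i \<in> sets M \<and> {x \<in> space M. \<not> P x} \<subseteq> A i"
  shows "AE x in M. P x"
proof -
  have "\<exists>i. A i \<in> sets M \<and> {x \<in> space M. \<not> P x} \<subseteq> A i \<and> measure M (A i) < 1 / real (Suc k)" for k
  proof -
    have "\<forall>\<^sub>F i in F. measure M (A i) < 1 / real (Suc k)"
      by (rule order_tendstoD[OF lim]) simp
    with covers have "\<forall>\<^sub>F i in F. A i \<in> sets M \<and> {x \<in> space M. \<not> P x} \<subseteq> A i \<and>
        measure M (A i) < 1 / real (Suc k)"
      by eventually_elim simp
    then show ?thesis by (rule eventually_happens'[OF \<open>F \<noteq> bot\<close>])
  qed
  then obtain i where small_cover: "\<And>k. A (i k) \<in> sets M" "\<And>k. {x \<in> space M. \<not> P x} \<subseteq> A (i k)"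
    "\<And>k. measure M (A (i k)) < 1 / real (Suc k)"
    by metis
  define Z where "Z = (\<Inter>k. A (i k))"
  have Z_sets: "Z \<in> sets M" using small_cover(1) by (auto simp: Z_def)
  have "measure M Z < 1 / real (Suc k)" for k
    using finite_measure_mono[of Z "A (i k)"] small_cover(1,3)[of k] by (force simp: Z_def)
  then have "measure M Z \<le> 0"
    by (metis nat_approx_posE not_le order_less_asym)
  then have "Z \<in> null_sets M"
    using Z_sets by (simp add: null_sets_def emeasure_eq_measure measure_le_0_iff)
  then show ?thesis
    by (rule AE_I') (use small_cover(2) in \<open>auto simp: Z_def\<close>)
qed

subsection \<open>Simultaneous approximation with random shifts\<close>

definition unit_grid :: "nat \<Rightarrow> real set" where
  "unit_grid K = (\<lambda>i. real i / real K) ` {..<K}"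

lemma finite_unit_grid [simp]: "finite (unit_grid K)"
  by (simp add: unit_grid_def)

lemma card_unit_grid_le: "card (unit_grid K) \<le> K"
  using card_image_le[of "{..<K}"] by (simp add: unit_grid_def)

lemma ex_unit_grid_near:
  assumes "0 < K" "0 \<le> x" "x < 1"
  shows "\<exists>a\<in>unit_grid K. \<bar>x - a\<bar> \<le> 1 / real K"
proof
  define i where "i = nat \<lfloor>real K * x\<rfloor>"
  have "real K * x < real K" "0 \<le> real K * x" using assms by simp_all
  then have "i < K" "\<bar>real K * x - real i\<bar> \<le> 1" unfolding i_def by linarith+
  then show "real i / real K \<in> unit_grid K" by (simp add: unit_grid_def)
  have "x - real i / real K = (real K * x - real i) / real K"
    using assms by (simp add: field_simps)
  then show "\<bar>x - real i / real K\<bar> \<le> 1 / real K"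
    using \<open>\<bar>real K * x - real i\<bar> \<le> 1\<close> by (simp add: divide_right_mono)
qed

locale uniform_shifts = prob_space M for M :: "'a measure" +
  fixes \<gamma> \<delta> :: "nat \<Rightarrow> 'a \<Rightarrow> real"
  assumes indep: "indep_vars (\<lambda>_. borel) (case_sum \<gamma> \<delta>) ({1..} <+> {1..})"
    and distr_\<gamma>: "1 \<le> n \<Longrightarrow> distr M borel (\<gamma> n) = uniform_measure lborel {0..<1}"
    and distr_\<delta>: "1 \<le> n \<Longrightarrow> distr M borel (\<delta> n) = uniform_measure lborel {0..<1}"
begin

definition weighted_product :: "real \<Rightarrow> real \<Rightarrow> nat \<Rightarrow> 'a \<Rightarrow> real" where
  "weighted_product \<alpha> \<beta> n \<omega> = real n * ln (real n) *
    nint_dist (real n * \<alpha> - \<gamma> n \<omega>) * nint_dist (real n * \<beta> - \<delta> n \<omega>)"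

lemma random_variable_shifts:
  assumes "1 \<le> n"
  shows "random_variable borel (\<gamma> n)" "random_variable borel (\<delta> n)"
proof -
  have "random_variable borel (case_sum \<gamma> \<delta> i)" if "i \<in> {1..} <+> {1..}" for i
    using indep that unfolding indep_vars_def by blast
  from this[of "Inl n"] this[of "Inr n"] assms
  show "random_variable borel (\<gamma> n)" "random_variable borel (\<delta> n)" by auto
qed

lemma indep_vars_weighted_product: "indep_vars (\<lambda>_. borel) (weighted_product \<alpha> \<beta>) {1..}"
proof -
  let ?I = "\<lambda>n. {Inl n, Inr n}"
  let ?f = "\<lambda>n x. real n * ln (real n) *
    nint_dist (real n * \<alpha> - x (Inl n)) * nint_dist (real n * \<beta> - x (Inr n))"
  have "indep_vars (\<lambda>n. PiM (?I n) (\<lambda>_. borel)) (\<lambda>n \<omega>. \<lambda>i\<in>?I n. case_sum \<gamma> \<delta> i \<omega>) {1..}"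
    by (rule indep_vars_restrict[OF indep]) (auto simp: disjoint_family_on_def)
  then have "indep_vars (\<lambda>_. borel) (\<lambda>n \<omega>. ?f n (\<lambda>i\<in>?I n. case_sum \<gamma> \<delta> i \<omega>)) {1..}"
    by (rule indep_vars_compose2) measurable
  then show ?thesis by (simp add: weighted_product_def[abs_def])
qed

lemma borel_measurable_weighted_product:
  assumes "1 \<le> n"
  shows "weighted_product \<alpha> \<beta> n \<in> borel_measurable M"
  using indep_vars_weighted_product assms unfolding indep_vars_def by blast

lemma prob_nint_dist_mult_le:
  fixes a b t :: real
  assumes "1 \<le> n" "0 < t" "4 * t \<le> 1"
  shows "\<P>(\<omega> in M. nint_dist (a - \<gamma> n \<omega>) * nint_dist (b - \<delta> n \<omega>) \<le> t) = 4 * t * (1 - ln (4 * t))"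
proof -
  have "indep_var borel (\<gamma> n) borel (\<delta> n)"
    using indep_vars_imp_indep_var[OF indep, of "Inl n" "Inr n"] assms by auto
  then have "indep_var borel ((\<lambda>x. nint_dist (a - x)) \<circ> \<gamma> n) borel ((\<lambda>y. nint_dist (b - y)) \<circ> \<delta> n)"
    by (rule indep_var_compose) measurable
  then have "\<P>(\<omega> in M. nint_dist (a - \<gamma> n \<omega>) * nint_dist (b - \<delta> n \<omega>) \<le> t) =
      t / (1 / 2 * (1 / 2)) * (1 - ln (t / (1 / 2 * (1 / 2))))"
    using assms
    by (intro prob_mult_indep_uniform_le distributed_nint_dist_diff_uniform
      random_variable_shifts distr_\<gamma> distr_\<delta>) (simp_all add: comp_def)
  then show ?thesis by (simp add: mult.commute)
qed

lemma prob_weighted_product_le_lower_bound: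
  assumes "0 < c" "4 * c \<le> ln (real n)"
  shows "4 * c / real n \<le> \<P>(\<omega> in M. weighted_product \<alpha> \<beta> n \<omega> \<le> c)"
proof -
  define t where "t = c / (real n * ln (real n))"
  have ln_pos: "0 < ln (real n)" using assms by linarith
  then have n_ge_1: "1 \<le> n" by (cases n) auto
  have t_bounds: "0 < t" "4 * t \<le> 1 / real n"
    using assms ln_pos n_ge_1 by (simp_all add: t_def field_simps)
  have "4 * c / real n = 4 * t * ln (real n)"
    using ln_pos by (simp add: t_def)
  also have "\<dots> \<le> 4 * t * (1 - ln (4 * t))"
  proof -
    have "ln (4 * t) \<le> ln (1 / real n)" using t_bounds n_ge_1 by simp
    then show ?thesis using t_bounds n_ge_1 by (intro mult_left_mono) (simp_all add: ln_div)
  qed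
  also have "\<dots> = \<P>(\<omega> in M. nint_dist (real n * \<alpha> - \<gamma> n \<omega>) * nint_dist (real n * \<beta> - \<delta> n \<omega>) \<le> t)"
  proof (rule prob_nint_dist_mult_le[symmetric])
    have "1 / real n \<le> 1" using n_ge_1 by simp
    with t_bounds(2) show "4 * t \<le> 1" by linarith
  qed fact+
  also have "\<dots> = \<P>(\<omega> in M. weighted_product \<alpha> \<beta> n \<omega> \<le> c)"
    using ln_pos n_ge_1 by (simp add: t_def weighted_product_def pos_le_divide_eq mult_ac)
  finally show ?thesis .
qed

lemma prob_weighted_product_gt_le:
  assumes "0 < c" "4 * c \<le> ln (real n)"
  shows "\<P>(\<omega> in M. c < weighted_product \<alpha> \<beta> n \<omega>) \<le> (real n / real (Suc n)) powr (4 * c)"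
proof -
  have n_ge_1: "1 \<le> n" using assms by (cases n) auto
  have "\<P>(\<omega> in M. c < weighted_product \<alpha> \<beta> n \<omega>) =
      prob (space M - {\<omega> \<in> space M. weighted_product \<alpha> \<beta> n \<omega> \<le> c})"
    by (auto intro!: arg_cong[where f = prob])
  also have "\<dots> = 1 - \<P>(\<omega> in M. weighted_product \<alpha> \<beta> n \<omega> \<le> c)"
    using n_ge_1 by (intro prob_compl borel_measurable_le borel_measurable_weighted_product) auto
  also have "\<dots> \<le> 1 - 4 * c / real n"
    using prob_weighted_product_le_lower_bound[OF assms] by simp
  also have "\<dots> \<le> (real n / real (Suc n)) powr (4 * c)"
    using one_minus_divide_le_powr[of "real n" "4 * c"] n_ge_1 assms by (simp add: add.commute)
  finally show ?thesis .
qed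

definition exceeds_on :: "real \<Rightarrow> nat set \<Rightarrow> real \<Rightarrow> real \<Rightarrow> 'a set" where
  "exceeds_on c I \<alpha> \<beta> = {\<omega> \<in> space M. \<forall>n\<in>I. c < weighted_product \<alpha> \<beta> n \<omega>}"

lemma exceeds_on_in_events:
  assumes "I \<subseteq> {1..}"
  shows "exceeds_on c I \<alpha> \<beta> \<in> events"
proof -
  have "{\<omega> \<in> space M. c < weighted_product \<alpha> \<beta> n \<omega>} \<in> events" if "n \<in> I" for n
    using borel_measurable_weighted_product assms that by (intro borel_measurable_less) auto
  then show ?thesis unfolding exceeds_on_def by (intro sets.sets_Collect_countable_All') auto
qed

lemma prob_exceeds_on_le:
  assumes "N \<le> m" "0 < c" "4 * c \<le> ln (real N)"
  shows "prob (exceeds_on c {N..m} \<alpha> \<beta>) \<le> (real N / real (Suc m)) powr (4 * c)"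
proof -
  let ?E = "\<lambda>n. weighted_product \<alpha> \<beta> n -` {c<..} \<inter> space M"
  have N_ge_1: "1 \<le> N" using assms by (cases N) auto
  have "exceeds_on c {N..m} \<alpha> \<beta> = (\<Inter>n\<in>{N..m}. ?E n)"
    using assms(1) by (auto simp: exceeds_on_def)
  also have "prob \<dots> = (\<Prod>n=N..m. prob (?E n))"
    using assms(1) N_ge_1 by (intro indep_varsD[OF indep_vars_weighted_product]) auto
  also have "\<dots> \<le> (\<Prod>n=N..m. (real n / real (Suc n)) powr (4 * c))"
  proof (intro prod_mono conjI)
    fix n assume n: "n \<in> {N..m}"
    then have "ln (real N) \<le> ln (real n)" using N_ge_1 by simp
    then have "4 * c \<le> ln (real n)" using assms by linarith
    moreover have "?E n = {\<omega> \<in> space M. c < weighted_product \<alpha> \<beta> n \<omega>}" by auto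
    ultimately show "prob (?E n) \<le> (real n / real (Suc n)) powr (4 * c)"
      using prob_weighted_product_gt_le assms by simp
  qed simp
  also have "\<dots> = (real N / real (Suc m)) powr (4 * c)"
    using prod_atLeastAtMost_telescope[OF assms(1), of real]
    by (simp flip: prod_powr_distrib)
  finally show ?thesis .
qed

lemma weighted_product_frac:
  "weighted_product (frac \<alpha>) (frac \<beta>) n \<omega> = weighted_product \<alpha> \<beta> n \<omega>"
proof -
  have "nint_dist (real n * frac x - g) = nint_dist (real n * x - g)" for x g
    using nint_dist.minus_of_int[of "real n * x - g" "int n * \<lfloor>x\<rfloor>"]
    by (simp add: frac_def algebra_simps)
  then show ?thesis by (simp add: weighted_product_def)
qed

lemma weighted_product_diff_le:
  "weighted_product \<alpha> \<beta> n \<omega> - weighted_product a b n \<omega>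
    \<le> (real n)\<^sup>2 * ln (real n) * ((\<bar>\<alpha> - a\<bar> + \<bar>\<beta> - b\<bar>) / 2)"
proof -
  let ?x = "\<lambda>\<theta>. real n * \<theta> - \<gamma> n \<omega>" and ?y = "\<lambda>\<theta>. real n * \<theta> - \<delta> n \<omega>"
  have "weighted_product \<alpha> \<beta> n \<omega> - weighted_product a b n \<omega> = real n * ln (real n) *
      (nint_dist (?x \<alpha>) * nint_dist (?y \<beta>) - nint_dist (?x a) * nint_dist (?y b))"
    by (simp add: weighted_product_def algebra_simps)
  also have "\<dots> \<le> real n * ln (real n) * ((\<bar>?x \<alpha> - ?x a\<bar> + \<bar>?y \<beta> - ?y b\<bar>) / 2)"
    by (intro mult_left_mono nint_dist_mult_diff_le) (cases n; simp)
  also have "\<bar>?x \<alpha> - ?x a\<bar> + \<bar>?y \<beta> - ?y b\<bar> = real n * (\<bar>\<alpha> - a\<bar> + \<bar>\<beta> - b\<bar>)"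
    by (simp add: abs_mult distrib_left flip: right_diff_distrib)
  finally show ?thesis by (simp add: power2_eq_square mult_ac)
qed

definition grid_exceeds_on :: "real \<Rightarrow> nat set \<Rightarrow> nat \<Rightarrow> 'a set" where
  "grid_exceeds_on c I K = (\<Union>(a, b)\<in>unit_grid K \<times> unit_grid K. exceeds_on c I a b)"

lemma grid_exceeds_on_in_events: "I \<subseteq> {1..} \<Longrightarrow> grid_exceeds_on c I K \<in> events"
  unfolding grid_exceeds_on_def by (intro sets.finite_UN) (use exceeds_on_in_events in auto)

lemma prob_grid_exceeds_on_le:
  assumes "N \<le> m" "0 < c" "4 * c \<le> ln (real N)"
  shows "prob (grid_exceeds_on c {N..m} K) \<le> (real K)\<^sup>2 * (real N / real (Suc m)) powr (4 * c)"
proof -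
  let ?G = "unit_grid K \<times> unit_grid K" and ?p = "(real N / real (Suc m)) powr (4 * c)"
  have "{N..m} \<subseteq> {1..}" using assms by (cases N) auto
  then have "prob (grid_exceeds_on c {N..m} K) \<le> (\<Sum>(a, b)\<in>?G. prob (exceeds_on c {N..m} a b))"
    unfolding grid_exceeds_on_def case_prod_unfold
    by (intro finite_measure_subadditive_finite) (auto intro: exceeds_on_in_events)
  also have "\<dots> \<le> real (card ?G) * ?p"
    using prob_exceeds_on_le[OF assms] by (intro sum_bounded_above) auto
  also have "\<dots> \<le> (real K)\<^sup>2 * ?p"
    using card_unit_grid_le[of K]
    by (intro mult_right_mono) (simp_all add: card_cartesian_product power2_eq_square mult_mono)
  finally show ?thesis .
qed

lemma exceeds_on_subset_grid_exceeds_on: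
  assumes "0 < K" "(real m)\<^sup>2 * ln (real m) \<le> \<epsilon> * real K"
  shows "exceeds_on (c + \<epsilon>) {N..m} \<alpha> \<beta> \<subseteq> grid_exceeds_on c {N..m} K"
proof
  fix \<omega> assume \<omega>: "\<omega> \<in> exceeds_on (c + \<epsilon>) {N..m} \<alpha> \<beta>"
  obtain a where a_near: "a \<in> unit_grid K" "\<bar>frac \<alpha> - a\<bar> \<le> 1 / real K"
    using ex_unit_grid_near[OF assms(1) frac_ge_0 frac_lt_1] by blast
  obtain b where b_near: "b \<in> unit_grid K" "\<bar>frac \<beta> - b\<bar> \<le> 1 / real K"
    using ex_unit_grid_near[OF assms(1) frac_ge_0 frac_lt_1] by blast
  have "c < weighted_product a b n \<omega>" if n: "n \<in> {N..m}" for n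
  proof -
    have "weighted_product \<alpha> \<beta> n \<omega> - weighted_product a b n \<omega>
        \<le> (real n)\<^sup>2 * ln (real n) * ((\<bar>frac \<alpha> - a\<bar> + \<bar>frac \<beta> - b\<bar>) / 2)"
      using weighted_product_diff_le[of "frac \<alpha>" "frac \<beta>"] by (simp add: weighted_product_frac)
    also have "\<dots> \<le> (real m)\<^sup>2 * ln (real m) * (1 / real K)"
      using n a_near(2) b_near(2) power2_mult_ln_mono[of 0 m]
      by (intro mult_mono[OF power2_mult_ln_mono]) auto
    also have "\<dots> \<le> \<epsilon>"
      using assms by (simp add: field_simps)
    finally show ?thesis using \<omega> n by (force simp: exceeds_on_def)
  qed
  with \<omega> have "\<omega> \<in> exceeds_on c {N..m} a b" by (simp add: exceeds_on_def)
  with a_near(1) b_near(1) show "\<omega> \<in> grid_exceeds_on c {N..m} K"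
    unfolding grid_exceeds_on_def by blast
qed

definition grid_size :: "real \<Rightarrow> nat \<Rightarrow> nat" where
  "grid_size c m = nat \<lceil>real m powr (1 + c)\<rceil>"

lemma prob_grid_exceeds_on_tendsto_0:
  assumes "1 < c" "4 * c \<le> ln (real N)"
  shows "(\<lambda>m. prob (grid_exceeds_on c {N..m} (grid_size c m))) \<longlonglongrightarrow> 0"
proof (rule Lim_null_comparison)
  show "\<forall>\<^sub>F m in sequentially. norm (prob (grid_exceeds_on c {N..m} (grid_size c m)))
      \<le> (real (grid_size c m))\<^sup>2 * (real N / real (Suc m)) powr (4 * c)"
    using eventually_ge_at_top[of N]
    by eventually_elim (use prob_grid_exceeds_on_le assms in simp)
  have "1 \<le> N" using assms by (cases N) auto
  then show "(\<lambda>m. (real (grid_size c m))\<^sup>2 * (real N / real (Suc m)) powr (4 * c)) \<longlonglongrightarrow> 0"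
    unfolding grid_size_def using assms by real_asymp
qed

lemma AE_not_exceeds_on:
  assumes "1 < c'" "c' < c" "4 * c' \<le> ln (real N)"
  shows "AE \<omega> in M. \<forall>\<alpha> \<beta>. \<omega> \<notin> exceeds_on c {N..} \<alpha> \<beta>"
proof (rule AE_I_cover_tendsto_0)
  let ?A = "\<lambda>m. grid_exceeds_on c' {N..m} (grid_size c' m)"
  show "(\<lambda>m. prob (?A m)) \<longlonglongrightarrow> 0"
    using assms by (intro prob_grid_exceeds_on_tendsto_0)
  have "\<forall>\<^sub>F m in sequentially. 0 < grid_size c' m \<and>
      (real m)\<^sup>2 * ln (real m) \<le> (c - c') * real (grid_size c' m)"
    unfolding grid_size_def using assms by (intro eventually_conj; real_asymp)
  then show "\<forall>\<^sub>F m in sequentially. ?A m \<in> events \<and>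
      {\<omega> \<in> space M. \<not> (\<forall>\<alpha> \<beta>. \<omega> \<notin> exceeds_on c {N..} \<alpha> \<beta>)} \<subseteq> ?A m"
  proof eventually_elim
    case (elim m)
    have "exceeds_on c {N..} \<alpha> \<beta> \<subseteq> ?A m" for \<alpha> \<beta>
    proof -
      have "exceeds_on c {N..} \<alpha> \<beta> \<subseteq> exceeds_on c {N..m} \<alpha> \<beta>"
        by (auto simp: exceeds_on_def)
      also have "\<dots> \<subseteq> ?A m"
        using exceeds_on_subset_grid_exceeds_on[of "grid_size c' m" m "c - c'" c'] elim by simp
      finally show ?thesis .
    qed
    moreover have "{N..m} \<subseteq> {1..}" using assms by (cases N) auto
    ultimately show ?case using grid_exceeds_on_in_events by blast
  qed
qed simp

lemma AE_frequently_weighted_product_le: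
  assumes "1 < c"
  shows "AE \<omega> in M. \<forall>\<alpha> \<beta>. \<exists>\<^sub>F n in sequentially. weighted_product \<alpha> \<beta> n \<omega> \<le> c"
proof -
  obtain c' where c'_between: "1 < c'" "c' < c" using dense[OF assms] by blast
  have "\<forall>\<^sub>F n in sequentially. 4 * c' \<le> ln (real n)" by real_asymp
  then obtain N\<^sub>0 where N\<^sub>0_large: "\<And>n. N\<^sub>0 \<le> n \<Longrightarrow> 4 * c' \<le> ln (real n)"
    unfolding eventually_sequentially by blast
  have "AE \<omega> in M. \<forall>N. \<forall>\<alpha> \<beta>. \<omega> \<notin> exceeds_on c {max N N\<^sub>0..} \<alpha> \<beta>"
    unfolding AE_all_countable by (intro allI AE_not_exceeds_on[OF c'_between] N\<^sub>0_large) simp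
  with AE_space show ?thesis
  proof eventually_elim
    case (elim \<omega>)
    then have "\<exists>n\<ge>max N N\<^sub>0. weighted_product \<alpha> \<beta> n \<omega> \<le> c" for N \<alpha> \<beta>
      by (force simp: exceeds_on_def not_less)
    then show ?case
      unfolding frequently_sequentially by (meson max.bounded_iff)
  qed
qed

end

theorem theorem1:
  fixes M :: "'a measure" and \<gamma> \<delta> :: "nat \<Rightarrow> 'a \<Rightarrow> real"
  assumes "prob_space M"
    and "prob_space.indep_vars M (\<lambda>_. borel) (case_sum \<gamma> \<delta>) ({1..} <+> {1..})"
    and "\<And>n. n \<ge> 1 \<Longrightarrow> distr M borel (\<gamma> n) = uniform_measure lborel {0..<1}"
    and "\<And>n. n \<ge> 1 \<Longrightarrow> distr M borel (\<delta> n) = uniform_measure lborel {0..<1}"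
  shows "AE \<omega> in M. \<forall>\<alpha> \<beta> :: real.
    liminf (\<lambda>n. ereal (real n * ln (real n) *
      nint_dist (real n * \<alpha> - \<gamma> n \<omega>) * nint_dist (real n * \<beta> - \<delta> n \<omega>))) \<le> 1"
proof -
  interpret uniform_shifts M \<gamma> \<delta>
    using assms by (simp add: uniform_shifts_def uniform_shifts_axioms_def)
  have "AE \<omega> in M. \<forall>q :: rat. 1 < real_of_rat q \<longrightarrow>
      (\<forall>\<alpha> \<beta>. \<exists>\<^sub>F n in sequentially. weighted_product \<alpha> \<beta> n \<omega> \<le> of_rat q)"
    unfolding AE_all_countable by (intro allI AE_impI AE_frequently_weighted_product_le)
  then have "AE \<omega> in M. \<forall>\<alpha> \<beta>. liminf (\<lambda>n. ereal (weighted_product \<alpha> \<beta> n \<omega>)) \<le> ereal 1"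
  proof eventually_elim
    case (elim \<omega>)
    then show ?case by (intro allI Liminf_ereal_le_if_frequently_rat) simp
  qed
  then show ?thesis by (simp add: weighted_product_def one_ereal_def)
qed

end
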